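(* Let $S,\tilde S,H$ be the Gauss–Borel factors of the moment matrix $g$ of the system $(w_1,w_2,\mathrm d\mu)$, and let $B,A_1,A_2,Q$ be the associated vectors of multiple orthogonal polynomials and linear forms. Let $T:=S\Lambda S^{-1}$. (i) $T B=xB$, $T^\top A_1=xA_1$, $T^\top A_2=xA_2$, $T^\top Q=xQ$. (ii) The lower Hessenberg matrix $\hat T:=H^{-1}\tilde T H$, with $\tilde T:=\tilde S\Lambda\tilde S^{-1}$, satisfies $$T^\top=\hat T^2,\qquad \hat T A_1=xA_2,\qquad \hat T A_2=A_1 .$$ Moreover, if $T_1:=H^{-1}\tilde S\Lambda_1\tilde S^{-1}H$ and $T_2:=H^{-1}\tilde S\Lambda_2\tilde S^{-1}H$, then $$T_1A_1=xA_1,\qquad T_2A_2=xA_2,\qquad T_1A_2=\mathbf 0,\qquad T_2A_1=\mathbf 0 .$$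
   Context: Let $\Delta\subset\mathbb R$ be an interval, $\mu$ a measure supported on $\Delta$, and $w_1,w_2$ weight functions on $\Delta$ such that all moments $\int_\Delta x^kw_a(x)\,\mathrm d\mu(x)$ exist. All vectors and matrices are semi-infinite, with rows and columns indexed by $0,1,2,\dots$. Put $X(x)=(1,x,x^2,\dots)^\top$, $X_1(x)=(1,0,x,0,x^2,0,\dots)^\top$, $X_2(x)=(0,1,0,x,0,x^2,\dots)^\top$. The moment matrix is $g=\int_\Delta X(x)\big(X_1(x)w_1(x)+X_2(x)w_2(x)\big)^\top\mathrm d\mu(x)$. Standing assumption (the system is perfect): $g$ has a Gauss–Borel factorization $g=S^{-1}H\tilde S^{-\top}$ with $S,\tilde S$ lower unitriangular and $H=\operatorname{diag}(H_0,H_1,\dots)$, all $H_n\ne0$. Set $B=SX$ (type II polynomials), $A_a=H^{-1}\tilde SX_a$, $a\in\{1,2\}$ (type I polynomials), $Q=w_1A_1+w_2A_2$ (type I linear forms). $\Lambda$ is the shift matrix with ones on the first superdiagonal and zeros elsewhere. $\Pi_1=\operatorname{diag}(1,0,1,0,\dots)$, $\Pi_2=\operatorname{diag}(0,1,0,1,\dots)$, $\Lambda_1=\Pi_1\Lambda^2$, $\Lambda_2=\Pi_2\Lambda^2$, so $\Lambda_1+\Lambda_2=\Lambda^2$. *)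

theory Defs
  imports "HOL-Analysis.Analysis" "HOL-Library.Groups_Big_Fun"
begin

type_synonym svec = "nat \<Rightarrow> real"
type_synonym smat = "nat \<Rightarrow> nat \<Rightarrow> real"

text \<open>
  Products of semi-infinite matrices are purely algebraic: \<^const>\<open>Sum_any\<close> adds up the finitely
  many nonzero terms, and returns 0 in the (meaningless) case of infinitely many nonzero terms.
  No infinite series is ever evaluated.
\<close>

definition smat_mult :: "smat \<Rightarrow> smat \<Rightarrow> smat"  (infixl "\<odot>" 70)
  where "A \<odot> B = (\<lambda>i j. Sum_any (\<lambda>k. A i k * B k j))"

definition smat_vec :: "smat \<Rightarrow> svec \<Rightarrow> svec"  (infixl "\<odot>\<^sub>v" 70)
  where "A \<odot>\<^sub>v v = (\<lambda>i. Sum_any (\<lambda>k. A i k * v k))"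

definition svec_scale :: "real \<Rightarrow> svec \<Rightarrow> svec"  (infixr "\<cdot>\<^sub>v" 72)
  where "c \<cdot>\<^sub>v v = (\<lambda>i. c * v i)"

definition smat_transpose :: "smat \<Rightarrow> smat"
  where "smat_transpose A = (\<lambda>i j. A j i)"

definition smat_one :: smat
  where "smat_one = (\<lambda>i j. if i = j then 1 else 0)"

definition lower_triangular :: "smat \<Rightarrow> bool"
  where "lower_triangular A \<longleftrightarrow> (\<forall>i j. i < j \<longrightarrow> A i j = 0)"

definition lower_unitriangular :: "smat \<Rightarrow> bool"
  where "lower_unitriangular A \<longleftrightarrow> lower_triangular A \<and> (\<forall>i. A i i = 1)"

definition diagonal :: "smat \<Rightarrow> bool"
  where "diagonal A \<longleftrightarrow> (\<forall>i j. i \<noteq> j \<longrightarrow> A i j = 0)"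

definition lower_Hessenberg :: "smat \<Rightarrow> bool"
  where "lower_Hessenberg A \<longleftrightarrow> (\<forall>i j. i + 1 < j \<longrightarrow> A i j = 0)"

text \<open>
  Inverse in the ring of lower triangular matrices.  It exists and is unique when the
  argument is lower triangular without zeros on the diagonal; it is used only for such arguments.
\<close>

definition smat_inv :: "smat \<Rightarrow> smat"
  where "smat_inv A =
    (THE R. lower_triangular R \<and> A \<odot> R = smat_one \<and> R \<odot> A = smat_one)"

definition X_vec :: "real \<Rightarrow> svec"
  where "X_vec x = (\<lambda>n. x ^ n)"

definition X1_vec :: "real \<Rightarrow> svec"
  where "X1_vec x = (\<lambda>n. if even n then x ^ (n div 2) else 0)"

definition X2_vec :: "real \<Rightarrow> svec"
  where "X2_vec x = (\<lambda>n. if odd n then x ^ (n div 2) else 0)"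

definition moment_matrix ::
    "real measure \<Rightarrow> real set \<Rightarrow> (real \<Rightarrow> real) \<Rightarrow> (real \<Rightarrow> real) \<Rightarrow> smat"
  where "moment_matrix \<mu> \<Delta> w1 w2 =
    (\<lambda>n m. LINT x:\<Delta>|\<mu>. X_vec x n * (X1_vec x m * w1 x + X2_vec x m * w2 x))"

definition gauss_borel :: "smat \<Rightarrow> smat \<Rightarrow> smat \<Rightarrow> smat \<Rightarrow> bool"
  where "gauss_borel g S H St \<longleftrightarrow>
    lower_unitriangular S \<and> lower_unitriangular St \<and>
    diagonal H \<and> (\<forall>n. H n n \<noteq> 0) \<and>
    g = smat_inv S \<odot> H \<odot> smat_transpose (smat_inv St)"

definition Lam :: smat
  where "Lam = (\<lambda>i j. if j = i + 1 then 1 else 0)"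

definition Pi1 :: smat
  where "Pi1 = (\<lambda>i j. if i = j \<and> even i then 1 else 0)"

definition Pi2 :: smat
  where "Pi2 = (\<lambda>i j. if i = j \<and> odd i then 1 else 0)"

definition Lam1 :: smat
  where "Lam1 = Pi1 \<odot> (Lam \<odot> Lam)"

definition Lam2 :: smat
  where "Lam2 = Pi2 \<odot> (Lam \<odot> Lam)"

end

theory Submission
  imports Defs
begin

text \<open>
  Shifting a row of the moment matrix raises the power of $x$ by one, and so does shifting a column
  by two, since the entries of $X_1$ and $X_2$ double up the powers. Hence
  $\Lambda g = g (\Lambda^2)^\top$, and inserting the Gauss--Borel factorization turns this into
  $T H = H \tilde S^{-\top} (\Lambda^2)^\top \tilde S^\top$, that is
  $T^\top = H^{-1} \tilde S \Lambda^2 \tilde S^{-1} H$. All remaining identities are the action of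
  $\Lambda$, $\Lambda_1$, $\Lambda_2$ on $X$, $X_1$, $X_2$, conjugated by $S$ or by
  $H^{-1} \tilde S$. Associativity of the semi-infinite products is not automatic: it is
  guaranteed by finiteness of the rows or the columns of the factors.
\<close>

subsection \<open>Row-finite matrices and associativity\<close>

definition row_finite :: "smat \<Rightarrow> bool"
  where "row_finite A \<longleftrightarrow> (\<forall>i. finite {k. A i k \<noteq> 0})"

lemma Sum_any_eq_sum:
  assumes "finite K" "\<And>k. k \<notin> K \<Longrightarrow> f k = 0"
  shows "Sum_any f = sum f K"
proof (rule Sum_any.expand_superset)
  show "{a. f a \<noteq> 0} \<subseteq> K" using assms(2) by blast
qed (fact assms(1))

text \<open>Under these hypotheses the double sum lives on the finite rectangle \<open>K\<close>
  times \<open>L\<close>, where the order of summation may be exchanged. Asking only for vanishing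
  products \<open>B k l * C l j\<close> covers both a row-finite \<open>B\<close> and a
  column-finite \<open>C\<close>.\<close>

lemma smat_mult_assoc_entry:
  assumes K: "finite K" "\<And>k. k \<notin> K \<Longrightarrow> A i k = 0"
    and L: "finite L" "\<And>k l. k \<in> K \<Longrightarrow> l \<notin> L \<Longrightarrow> B k l * C l j = 0"
  shows "(A \<odot> (B \<odot> C)) i j = (A \<odot> B \<odot> C) i j"
proof -
  have AB: "(A \<odot> B) i l = (\<Sum>k\<in>K. A i k * B k l)" for l
    unfolding smat_mult_def by (rule Sum_any_eq_sum) (use K in auto)
  have BC: "(B \<odot> C) k j = (\<Sum>l\<in>L. B k l * C l j)" if "k \<in> K" for k
    unfolding smat_mult_def by (rule Sum_any_eq_sum) (use L that in auto)
  have "(A \<odot> (B \<odot> C)) i j = (\<Sum>k\<in>K. A i k * (B \<odot> C) k j)"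
    unfolding smat_mult_def[of A "B \<odot> C"] by (rule Sum_any_eq_sum) (use K in auto)
  also have "\<dots> = (\<Sum>k\<in>K. \<Sum>l\<in>L. A i k * (B k l * C l j))"
    by (simp add: BC sum_distrib_left)
  also have "\<dots> = (\<Sum>l\<in>L. \<Sum>k\<in>K. A i k * (B k l * C l j))"
    by (rule sum.swap)
  also have "\<dots> = (\<Sum>l\<in>L. (A \<odot> B) i l * C l j)"
    by (simp add: AB sum_distrib_right mult.assoc)
  also have "\<dots> = (A \<odot> B \<odot> C) i j"
    unfolding smat_mult_def[of "A \<odot> B" C]
  proof (rule Sum_any_eq_sum[symmetric])
    fix l assume "l \<notin> L"
    then have "A i k * B k l * C l j = 0" if "k \<in> K" for k
      using L(2)[OF that] by (simp add: mult.assoc)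
    then have "(\<Sum>k\<in>K. A i k * B k l * C l j) = 0"
      by (rule sum.neutral[rule_format])
    then show "(A \<odot> B) i l * C l j = 0"
      by (simp only: AB sum_distrib_right)
  qed (fact L(1))
  finally show ?thesis .
qed

lemma smat_mult_assoc:
  assumes A: "row_finite A" and B: "row_finite B"
  shows "A \<odot> B \<odot> C = A \<odot> (B \<odot> C)"
proof (intro ext)
  fix i j
  show "(A \<odot> B \<odot> C) i j = (A \<odot> (B \<odot> C)) i j"
    by (rule smat_mult_assoc_entry[symmetric,
          where K = "{k. A i k \<noteq> 0}" and L = "\<Union>k\<in>{k. A i k \<noteq> 0}. {l. B k l \<noteq> 0}"])
       (use A B in \<open>auto simp: row_finite_def\<close>)
qed

text \<open>The middle factor may be arbitrary: row \<open>i\<close> of \<open>A\<close> and column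
  \<open>j\<close> of \<open>C\<close> already confine both summation indices to finite
  sets.\<close>

lemma smat_mult_assoc_outer:
  assumes A: "row_finite A" and C: "row_finite (smat_transpose C)"
  shows "A \<odot> B \<odot> C = A \<odot> (B \<odot> C)"
proof (intro ext)
  fix i j
  show "(A \<odot> B \<odot> C) i j = (A \<odot> (B \<odot> C)) i j"
    by (rule smat_mult_assoc_entry[symmetric,
          where K = "{k. A i k \<noteq> 0}" and L = "{l. C l j \<noteq> 0}"])
       (use A C in \<open>auto simp: row_finite_def smat_transpose_def\<close>)
qed

lemma smat_transpose_transpose [simp]: "smat_transpose (smat_transpose A) = A"
  by (simp add: smat_transpose_def)

lemma smat_transpose_mult:
  "smat_transpose (A \<odot> B) = smat_transpose B \<odot> smat_transpose A"
  by (simp add: smat_transpose_def smat_mult_def mult.commute)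

text \<open>The mirror image of \<open>smat_mult_assoc\<close> under transposition, for factors with
  finite columns such as transposes of lower triangular matrices.\<close>

lemma smat_mult_assoc_col:
  assumes "row_finite (smat_transpose B)" "row_finite (smat_transpose C)"
  shows "A \<odot> B \<odot> C = A \<odot> (B \<odot> C)"
proof -
  have "smat_transpose (A \<odot> B \<odot> C) = smat_transpose (A \<odot> (B \<odot> C))"
    using assms by (simp add: smat_transpose_mult smat_mult_assoc)
  then show ?thesis
    by (metis smat_transpose_transpose)
qed

lemma row_finite_mult:
  assumes A: "row_finite A" and B: "row_finite B"
  shows "row_finite (A \<odot> B)"
  unfolding row_finite_def
proof
  fix i
  let ?U = "\<Union>k\<in>{k. A i k \<noteq> 0}. {l. B k l \<noteq> 0}"
  have "(A \<odot> B) i l = 0" if "l \<notin> ?U" for l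
  proof -
    have "(\<lambda>k. A i k * B k l) = (\<lambda>k. 0)"
      using that by auto
    then show ?thesis by (simp only: smat_mult_def) simp
  qed
  then have "{l. (A \<odot> B) i l \<noteq> 0} \<subseteq> ?U" by blast
  moreover have "finite ?U" using A B by (auto simp: row_finite_def)
  ultimately show "finite {l. (A \<odot> B) i l \<noteq> 0}" by (rule finite_subset)
qed

text \<open>Reads a vector as the matrix all of whose columns equal it, so that laws for matrix
  products carry over; the column index \<open>j\<close> is arbitrary.\<close>

lemma smat_vec_eq_mult: "(A \<odot>\<^sub>v v) i = (A \<odot> (\<lambda>k _. v k)) i j"
  by (simp add: smat_vec_def smat_mult_def)

lemma smat_vec_assoc:
  assumes "row_finite A" "row_finite B"
  shows "A \<odot> B \<odot>\<^sub>v v = A \<odot>\<^sub>v (B \<odot>\<^sub>v v)"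
proof
  fix i
  have *: "B \<odot> (\<lambda>k _. v k) = (\<lambda>k _. (B \<odot>\<^sub>v v) k)"
    by (intro ext) (rule smat_vec_eq_mult[symmetric])
  have "(A \<odot> B \<odot>\<^sub>v v) i = (A \<odot> (B \<odot> (\<lambda>k _. v k))) i 0"
    unfolding smat_vec_eq_mult[where j = 0] smat_mult_assoc[OF assms] ..
  then show "(A \<odot> B \<odot>\<^sub>v v) i = (A \<odot>\<^sub>v (B \<odot>\<^sub>v v)) i"
    unfolding * by (simp add: smat_vec_eq_mult[where j = 0, symmetric])
qed

text \<open>A finite row turns all three products into sums over the same finite index set.
  \<open>Sum_any\<close> by itself is not additive, because of its default value 0 for infinite
  supports.\<close>

lemma smat_vec_linear:
  assumes "row_finite A"
  shows "A \<odot>\<^sub>v (\<lambda>n. a * u n + b * v n) = (\<lambda>n. a * (A \<odot>\<^sub>v u) n + b * (A \<odot>\<^sub>v v) n)"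
proof
  fix n
  have eq: "(A \<odot>\<^sub>v w) n = (\<Sum>k\<in>{k. A n k \<noteq> 0}. A n k * w k)" for w
    unfolding smat_vec_def by (rule Sum_any_eq_sum) (use assms in \<open>auto simp: row_finite_def\<close>)
  show "(A \<odot>\<^sub>v (\<lambda>n. a * u n + b * v n)) n = a * (A \<odot>\<^sub>v u) n + b * (A \<odot>\<^sub>v v) n"
    by (simp add: eq sum_distrib_left sum.distrib[symmetric] algebra_simps)
qed

lemma smat_vec_scale: "row_finite A \<Longrightarrow> A \<odot>\<^sub>v (c \<cdot>\<^sub>v v) = c \<cdot>\<^sub>v (A \<odot>\<^sub>v v)"
  using smat_vec_linear[of A c v 0 v] by (simp add: svec_scale_def)

lemma smat_vec_zero: "A \<odot>\<^sub>v (\<lambda>n. 0) = (\<lambda>n. 0)"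
  by (simp add: smat_vec_def)

lemma smat_one_mult [simp]: "smat_one \<odot> A = A"
proof (intro ext)
  fix i j
  have "(smat_one \<odot> A) i j = (\<Sum>k\<in>{i}. smat_one i k * A k j)"
    unfolding smat_mult_def by (rule Sum_any_eq_sum) (auto simp: smat_one_def)
  then show "(smat_one \<odot> A) i j = A i j" by (simp add: smat_one_def)
qed

lemma smat_transpose_one [simp]: "smat_transpose smat_one = smat_one"
  by (intro ext) (simp add: smat_transpose_def smat_one_def)

lemma smat_mult_one [simp]: "A \<odot> smat_one = A"
  by (metis smat_one_mult smat_transpose_mult smat_transpose_one smat_transpose_transpose)

subsection \<open>Inverses of lower triangular matrices\<close>

lemma row_finite_lower_triangular: "lower_triangular A \<Longrightarrow> row_finite A"
  unfolding row_finite_def lower_triangular_def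
  by (metis (mono_tags, lifting) finite_atMost atMost_iff finite_subset mem_Collect_eq
      not_le_imp_less subsetI)

lemma lower_triangular_mult_entry:
  assumes "lower_triangular A"
  shows "(A \<odot> B) i j = (\<Sum>k\<le>i. A i k * B k j)"
  unfolding smat_mult_def
  by (rule Sum_any_eq_sum) (use assms in \<open>auto simp: lower_triangular_def\<close>)

text \<open>Forward substitution: row \<open>i\<close> of the equation "\<open>A\<close> times the
  inverse is the identity" is solved for the entry \<open>(i, j)\<close>, using only rows
  \<open>k < i\<close>.\<close>

fun lower_inverse :: "smat \<Rightarrow> nat \<Rightarrow> nat \<Rightarrow> real"
  where "lower_inverse A i j =
    (if i < j then 0 else (smat_one i j - (\<Sum>k<i. A i k * lower_inverse A k j)) / A i i)"

declare lower_inverse.simps [simp del]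

lemma lower_triangular_lower_inverse: "lower_triangular (lower_inverse A)"
  by (simp add: lower_triangular_def lower_inverse.simps)

lemma lower_inverse_diag: "lower_inverse A i i = 1 / A i i"
proof -
  have "(\<Sum>k<i. A i k * lower_inverse A k i) = 0"
    by (rule sum.neutral) (simp add: lower_inverse.simps)
  then show ?thesis by (subst lower_inverse.simps) (simp add: smat_one_def)
qed

lemma lower_inverse_right:
  assumes A: "lower_triangular A" "\<And>i. A i i \<noteq> 0"
  shows "A \<odot> lower_inverse A = smat_one"
proof (intro ext)
  fix i j
  have "(A \<odot> lower_inverse A) i j
      = (\<Sum>k<i. A i k * lower_inverse A k j) + A i i * lower_inverse A i j"
    by (simp add: lower_triangular_mult_entry[OF A(1)] lessThan_Suc_atMost[symmetric])
  also have "\<dots> = smat_one i j"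
  proof (cases "i < j")
    case True
    then have "(\<Sum>k<i. A i k * lower_inverse A k j) = 0"
      by (intro sum.neutral) (simp add: lower_inverse.simps)
    with True show ?thesis by (simp add: lower_inverse.simps smat_one_def)
  next
    case False
    then show ?thesis using A(2) by (subst (2) lower_inverse.simps) simp
  qed
  finally show "(A \<odot> lower_inverse A) i j = smat_one i j" .
qed

text \<open>The right inverse \<open>R\<close> is itself lower triangular with nonzero diagonal, so
  it has a right inverse too. Associativity identifies that one with \<open>A\<close>.\<close>

lemma lower_inverse_left:
  assumes A: "lower_triangular A" "\<And>i. A i i \<noteq> 0"
  shows "lower_inverse A \<odot> A = smat_one"
proof -
  let ?R = "lower_inverse A"
  have RR: "?R \<odot> lower_inverse ?R = smat_one"
    by (rule lower_inverse_right) (simp_all add: lower_triangular_lower_inverse lower_inverse_diag A)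
  have "A = A \<odot> (?R \<odot> lower_inverse ?R)" by (simp add: RR)
  also have "\<dots> = lower_inverse ?R"
    by (simp add: smat_mult_assoc[symmetric] row_finite_lower_triangular A
        lower_triangular_lower_inverse lower_inverse_right)
  finally show ?thesis using RR by simp
qed

text \<open>Gives the definite description in \<open>smat_inv\<close> its meaning: existence is
  forward substitution, and uniqueness follows by inserting \<open>A \<odot> lower_inverse A\<close>
  to the right of a competitor \<open>R\<close>.\<close>

lemma smat_inv_eq_lower_inverse:
  assumes A: "lower_triangular A" "\<And>i. A i i \<noteq> 0"
  shows "smat_inv A = lower_inverse A"
  unfolding smat_inv_def
proof (rule the_equality)
  show "lower_triangular (lower_inverse A) \<and> A \<odot> lower_inverse A = smat_one
      \<and> lower_inverse A \<odot> A = smat_one"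
    by (simp add: lower_triangular_lower_inverse lower_inverse_right lower_inverse_left A)
next
  fix R assume R: "lower_triangular R \<and> A \<odot> R = smat_one \<and> R \<odot> A = smat_one"
  then have "R = R \<odot> (A \<odot> lower_inverse A)" by (simp add: lower_inverse_right A)
  also have "\<dots> = lower_inverse A"
    using R A by (simp add: smat_mult_assoc[symmetric] row_finite_lower_triangular)
  finally show "R = lower_inverse A" .
qed

lemma smat_inv:
  assumes "lower_triangular A" "\<And>i. A i i \<noteq> 0"
  shows "lower_triangular (smat_inv A)" "A \<odot> smat_inv A = smat_one" "smat_inv A \<odot> A = smat_one"
  by (simp_all add: smat_inv_eq_lower_inverse assms lower_triangular_lower_inverse
      lower_inverse_right lower_inverse_left)

section \<open>Hessenberg shape under multiplication by triangular factors\<close>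

lemma lower_Hessenberg_mult_left:
  assumes A: "lower_triangular A" and B: "lower_Hessenberg B"
  shows "lower_Hessenberg (A \<odot> B)"
  unfolding lower_Hessenberg_def
proof (intro allI impI)
  fix i j :: nat assume "i + 1 < j"
  then show "(A \<odot> B) i j = 0"
    unfolding lower_triangular_mult_entry[OF A]
    by (intro sum.neutral) (use B in \<open>auto simp: lower_Hessenberg_def\<close>)
qed

lemma lower_Hessenberg_mult_right:
  assumes A: "lower_Hessenberg A" and B: "lower_triangular B"
  shows "lower_Hessenberg (A \<odot> B)"
  unfolding lower_Hessenberg_def
proof (intro allI impI)
  fix i j :: nat assume ij: "i + 1 < j"
  \<comment> \<open>Either \<open>k > i + 1\<close> and \<open>A\<close> vanishes, or
    \<open>k \<le> i + 1 < j\<close> and \<open>B\<close> vanishes.\<close>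
  have "A i k * B k j = 0" for k
    using ij A B by (cases "i + 1 < k") (auto simp: lower_Hessenberg_def lower_triangular_def)
  then show "(A \<odot> B) i j = 0" by (simp only: smat_mult_def) simp
qed

subsection \<open>Shift matrices\<close>

lemma lower_Hessenberg_Lam: "lower_Hessenberg Lam"
  by (simp add: lower_Hessenberg_def Lam_def)

lemma row_finite_diagonal: "diagonal A \<Longrightarrow> row_finite A"
  by (rule row_finite_lower_triangular) (auto simp: diagonal_def lower_triangular_def)

lemma row_finite_Lam: "row_finite Lam"
  by (simp add: row_finite_def Lam_def)

lemma row_finite_Pi: "row_finite Pi1" "row_finite Pi2"
  by (simp_all add: row_finite_diagonal diagonal_def Pi1_def Pi2_def)

lemma Lam_mult: "(Lam \<odot> A) i j = A (Suc i) j"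
proof -
  have "(Lam \<odot> A) i j = (\<Sum>k\<in>{Suc i}. Lam i k * A k j)"
    unfolding smat_mult_def by (rule Sum_any_eq_sum) (auto simp: Lam_def)
  then show ?thesis by (simp add: Lam_def)
qed

lemma Lam_vec: "Lam \<odot>\<^sub>v v = (\<lambda>n. v (Suc n))"
  by (rule ext) (simp add: smat_vec_eq_mult[where j = 0] Lam_mult)

text \<open>Transposed, this is two successive row shifts by \<open>Lam_mult\<close>.\<close>

lemma mult_transpose_Lam_sq:
  "(A \<odot> smat_transpose (Lam \<odot> Lam)) i j = A i (Suc (Suc j))"
proof -
  have "A \<odot> smat_transpose (Lam \<odot> Lam) = smat_transpose (Lam \<odot> (Lam \<odot> smat_transpose A))"
    by (simp add: smat_transpose_mult smat_mult_assoc row_finite_Lam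
        smat_mult_assoc_col)
  then show ?thesis by (simp add: smat_transpose_def Lam_mult)
qed

lemma diagonal_vec:
  assumes "diagonal D"
  shows "D \<odot>\<^sub>v v = (\<lambda>n. D n n * v n)"
proof
  fix n
  have "(D \<odot>\<^sub>v v) n = (\<Sum>k\<in>{n}. D n k * v k)"
    unfolding smat_vec_def
    by (rule Sum_any_eq_sum) (use assms in \<open>auto simp: diagonal_def\<close>)
  then show "(D \<odot>\<^sub>v v) n = D n n * v n" by simp
qed

lemma row_finite_Lam12: "row_finite Lam1" "row_finite Lam2"
  by (simp_all add: Lam1_def Lam2_def row_finite_mult row_finite_Lam row_finite_Pi)

lemma Lam1_vec: "Lam1 \<odot>\<^sub>v v = (\<lambda>n. if even n then v (Suc (Suc n)) else 0)"
proof -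
  have "Lam1 \<odot>\<^sub>v v = Pi1 \<odot>\<^sub>v (Lam \<odot>\<^sub>v (Lam \<odot>\<^sub>v v))"
    by (simp add: Lam1_def smat_vec_assoc row_finite_mult row_finite_Lam row_finite_Pi)
  moreover have "diagonal Pi1" by (simp add: diagonal_def Pi1_def)
  ultimately show ?thesis by (simp add: Lam_vec diagonal_vec) (auto simp: Pi1_def)
qed

lemma Lam2_vec: "Lam2 \<odot>\<^sub>v v = (\<lambda>n. if odd n then v (Suc (Suc n)) else 0)"
proof -
  have "Lam2 \<odot>\<^sub>v v = Pi2 \<odot>\<^sub>v (Lam \<odot>\<^sub>v (Lam \<odot>\<^sub>v v))"
    by (simp add: Lam2_def smat_vec_assoc row_finite_mult row_finite_Lam row_finite_Pi)
  moreover have "diagonal Pi2" by (simp add: diagonal_def Pi2_def)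
  ultimately show ?thesis by (simp add: Lam_vec diagonal_vec) (auto simp: Pi2_def)
qed

section \<open>Action of the shift matrices on the monomial vectors\<close>

lemma Lam_X: "Lam \<odot>\<^sub>v X_vec x = x \<cdot>\<^sub>v X_vec x"
  by (simp add: Lam_vec X_vec_def svec_scale_def)

text \<open>A single shift exchanges the parities. Here it drops the leading 1, which costs a factor
  \<open>x\<close>; from \<open>X2_vec\<close> it drops only a leading 0, so \<open>Lam_X2\<close>
  has no such factor.\<close>

lemma Lam_X1: "Lam \<odot>\<^sub>v X1_vec x = x \<cdot>\<^sub>v X2_vec x"
  by (auto simp: Lam_vec X1_vec_def X2_vec_def svec_scale_def elim!: oddE)

lemma Lam_X2: "Lam \<odot>\<^sub>v X2_vec x = X1_vec x"
  by (auto simp: Lam_vec X1_vec_def X2_vec_def elim!: evenE)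

text \<open>A double shift keeps the parity and raises each power by one; the projection inside
  \<open>Lam1\<close> or \<open>Lam2\<close> then keeps or kills the result.\<close>

lemma Lam1_X1: "Lam1 \<odot>\<^sub>v X1_vec x = x \<cdot>\<^sub>v X1_vec x"
  by (auto simp: Lam1_vec X1_vec_def svec_scale_def)

lemma Lam1_X2: "Lam1 \<odot>\<^sub>v X2_vec x = (\<lambda>n. 0)"
  by (auto simp: Lam1_vec X2_vec_def)

lemma Lam2_X2: "Lam2 \<odot>\<^sub>v X2_vec x = x \<cdot>\<^sub>v X2_vec x"
  by (auto simp: Lam2_vec X2_vec_def svec_scale_def)

lemma Lam2_X1: "Lam2 \<odot>\<^sub>v X1_vec x = (\<lambda>n. 0)"
  by (auto simp: Lam2_vec X1_vec_def)

text \<open>The integrands on both sides agree pointwise: passing from \<open>m\<close> to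
  \<open>m + 2\<close> keeps the parity and raises \<open>m div 2\<close> by one.\<close>

lemma moment_matrix_shift:
  "Lam \<odot> moment_matrix \<mu> \<Delta> w1 w2 = moment_matrix \<mu> \<Delta> w1 w2 \<odot> smat_transpose (Lam \<odot> Lam)"
proof (intro ext)
  fix n m
  have "X_vec x (Suc n) * (X1_vec x m * w1 x + X2_vec x m * w2 x)
      = X_vec x n * (X1_vec x (Suc (Suc m)) * w1 x + X2_vec x (Suc (Suc m)) * w2 x)" for x
    by (simp add: X_vec_def X1_vec_def X2_vec_def)
  then show "(Lam \<odot> moment_matrix \<mu> \<Delta> w1 w2) n m
      = (moment_matrix \<mu> \<Delta> w1 w2 \<odot> smat_transpose (Lam \<odot> Lam)) n m"
    unfolding Lam_mult mult_transpose_Lam_sq moment_matrix_def by simp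
qed

subsection \<open>Conjugation\<close>

text \<open>The inner pair \<open>K' \<odot> K\<close> cancels, so relations for a shift acting on
  \<open>v\<close> become relations for its conjugate acting on
  \<open>K \<odot>\<^sub>v v\<close>.\<close>

lemma conj_vec:
  assumes "row_finite K" "row_finite M" "row_finite K'" "K' \<odot> K = smat_one"
  shows "K \<odot> M \<odot> K' \<odot>\<^sub>v (K \<odot>\<^sub>v v) = K \<odot>\<^sub>v (M \<odot>\<^sub>v v)"
proof -
  have "K \<odot> M \<odot> K' \<odot>\<^sub>v (K \<odot>\<^sub>v v) = K \<odot> M \<odot> K' \<odot> K \<odot>\<^sub>v v"
    by (simp add: smat_vec_assoc row_finite_mult assms)
  also have "K \<odot> M \<odot> K' \<odot> K = K \<odot> M"
    by (simp add: smat_mult_assoc row_finite_mult assms)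
  also have "K \<odot> M \<odot>\<^sub>v v = K \<odot>\<^sub>v (M \<odot>\<^sub>v v)"
    by (simp add: smat_vec_assoc assms)
  finally show ?thesis .
qed

lemma conj_conj:
  assumes "row_finite K" "row_finite M" "row_finite N" "row_finite K'" "K' \<odot> K = smat_one"
  shows "(K \<odot> M \<odot> K') \<odot> (K \<odot> N \<odot> K') = K \<odot> (M \<odot> N) \<odot> K'"
proof -
  have "K' \<odot> (K \<odot> (N \<odot> K')) = N \<odot> K'"
    by (simp add: smat_mult_assoc[symmetric] row_finite_mult assms)
  then show ?thesis by (simp add: smat_mult_assoc row_finite_mult assms)
qed

text \<open>Multiplying the symmetry of \<open>g\<close> by \<open>S\<close> on the left and by the
  transpose of \<open>St\<close> on the right cancels the outer factors of \<open>g\<close>. Since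
  \<open>g\<close> need not have finite rows or columns, each regrouping needs the associativity law
  that fits its factors.\<close>

lemma gauss_borel_transfer:
  assumes gb: "gauss_borel g S H St" and shift: "Lam \<odot> g = g \<odot> smat_transpose M"
    and M: "row_finite M"
  shows "smat_transpose (S \<odot> Lam \<odot> smat_inv S)
       = (smat_inv H \<odot> St) \<odot> M \<odot> (smat_inv St \<odot> H)"
proof -
  have SS: "lower_triangular S" "\<And>i. S i i \<noteq> 0" and SSt: "lower_triangular St" "\<And>i. St i i \<noteq> 0"
    and HH: "lower_triangular H" "\<And>i. H i i \<noteq> 0" and HT: "smat_transpose H = H"
    and g: "g = smat_inv S \<odot> H \<odot> smat_transpose (smat_inv St)"
    using gb by (auto simp: gauss_borel_def lower_unitriangular_def diagonal_def
        lower_triangular_def smat_transpose_def fun_eq_iff) metis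
  note inv = smat_inv[OF SS] smat_inv[OF SSt] smat_inv[OF HH]
  note rf [simp] = row_finite_Lam M
    row_finite_lower_triangular[OF SS(1)] row_finite_lower_triangular[OF SSt(1)]
    row_finite_lower_triangular[OF HH(1)] inv(1,4,7)[THEN row_finite_lower_triangular]
    row_finite_mult
  let ?T = "S \<odot> Lam \<odot> smat_inv S"
  let ?U = "smat_transpose (smat_inv St)" and ?V = "smat_transpose St"
  have UV: "?U \<odot> ?V = smat_one"
    using arg_cong[OF inv(5), of smat_transpose] by (simp add: smat_transpose_mult)
  \<comment> \<open>All factors to the left of \<open>?U\<close> have finite rows; the cancellation
    of \<open>?U\<close> against \<open>?V\<close> afterwards uses finite columns.\<close>
  have "S \<odot> (Lam \<odot> g) = (?T \<odot> H) \<odot> ?U"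
    unfolding g by (simp add: smat_mult_assoc)
  then have L: "S \<odot> (Lam \<odot> g) \<odot> ?V = ?T \<odot> H"
    by (simp add: smat_mult_assoc_col UV)
  have "g \<odot> smat_transpose M = (smat_inv S \<odot> H) \<odot> (?U \<odot> smat_transpose M)"
    unfolding g by (simp add: smat_mult_assoc_col)
  then have "S \<odot> (g \<odot> smat_transpose M) = (S \<odot> (smat_inv S \<odot> H)) \<odot> (?U \<odot> smat_transpose M)"
    by (simp add: smat_mult_assoc)
  also have "S \<odot> (smat_inv S \<odot> H) = H"
    by (simp add: smat_mult_assoc[symmetric] inv)
  \<comment> \<open>\<open>H\<close> has finite rows and \<open>?V\<close> finite columns, so
    \<open>?V\<close> can be moved inside.\<close>
  finally have "S \<odot> (g \<odot> smat_transpose M) \<odot> ?V = H \<odot> ((?U \<odot> smat_transpose M) \<odot> ?V)"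
    by (simp add: smat_mult_assoc_outer)
  with L shift have "?T \<odot> H = H \<odot> ((?U \<odot> smat_transpose M) \<odot> ?V)" by simp
  from arg_cong[OF this, of smat_transpose]
  have "H \<odot> smat_transpose ?T = (St \<odot> (M \<odot> smat_inv St)) \<odot> H"
    \<comment> \<open>Only these instances of the transposition rule are used, so that the transpose
      of \<open>?T\<close> stays in one piece.\<close>
    by (simp add: smat_transpose_mult[of _ H] smat_transpose_mult[of H] HT
        smat_transpose_mult[of _ ?V] smat_transpose_mult[of ?U])
  then have "smat_inv H \<odot> (H \<odot> smat_transpose ?T) = smat_inv H \<odot> ((St \<odot> (M \<odot> smat_inv St)) \<odot> H)"
    by simp
  also have "smat_inv H \<odot> (H \<odot> smat_transpose ?T) = smat_transpose ?T"
    by (simp add: smat_mult_assoc[symmetric] inv)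
  finally show ?thesis by (simp add: smat_mult_assoc)
qed

theorem theorem1:
  fixes \<mu> :: "real measure" and \<Delta> :: "real set" and w1 w2 :: "real \<Rightarrow> real"
    and S St H T Tt That T1 T2 :: smat
    and B A1 A2 Q :: "real \<Rightarrow> svec"
  assumes "is_interval \<Delta>"
    and "sets \<mu> = sets borel"
    and "emeasure \<mu> (- \<Delta>) = 0"
    and "\<And>k. set_integrable \<mu> \<Delta> (\<lambda>x. x ^ k * w1 x)"
    and "\<And>k. set_integrable \<mu> \<Delta> (\<lambda>x. x ^ k * w2 x)"
    and "gauss_borel (moment_matrix \<mu> \<Delta> w1 w2) S H St"
    and "\<And>x. B x = S \<odot>\<^sub>v X_vec x"
    and "\<And>x. A1 x = smat_inv H \<odot> St \<odot>\<^sub>v X1_vec x"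
    and "\<And>x. A2 x = smat_inv H \<odot> St \<odot>\<^sub>v X2_vec x"
    and "\<And>x. Q x = (\<lambda>n. w1 x * A1 x n + w2 x * A2 x n)"
    and "T = S \<odot> Lam \<odot> smat_inv S"
    and "Tt = St \<odot> Lam \<odot> smat_inv St"
    and "That = smat_inv H \<odot> Tt \<odot> H"
    and "T1 = smat_inv H \<odot> St \<odot> Lam1 \<odot> smat_inv St \<odot> H"
    and "T2 = smat_inv H \<odot> St \<odot> Lam2 \<odot> smat_inv St \<odot> H"
  shows "(\<forall>x. T \<odot>\<^sub>v B x = x \<cdot>\<^sub>v B x \<and>
              smat_transpose T \<odot>\<^sub>v A1 x = x \<cdot>\<^sub>v A1 x \<and>
              smat_transpose T \<odot>\<^sub>v A2 x = x \<cdot>\<^sub>v A2 x \<and>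
              smat_transpose T \<odot>\<^sub>v Q x = x \<cdot>\<^sub>v Q x) \<and>
         lower_Hessenberg That \<and>
         smat_transpose T = That \<odot> That \<and>
         (\<forall>x. That \<odot>\<^sub>v A1 x = x \<cdot>\<^sub>v A2 x \<and>
              That \<odot>\<^sub>v A2 x = A1 x) \<and>
         (\<forall>x. T1 \<odot>\<^sub>v A1 x = x \<cdot>\<^sub>v A1 x \<and>
              T2 \<odot>\<^sub>v A2 x = x \<cdot>\<^sub>v A2 x \<and>
              T1 \<odot>\<^sub>v A2 x = (\<lambda>n. 0) \<and>
              T2 \<odot>\<^sub>v A1 x = (\<lambda>n. 0))"
proof -
  have S: "lower_triangular S" "\<And>i. S i i \<noteq> 0" and St: "lower_triangular St" "\<And>i. St i i \<noteq> 0"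
    and H: "lower_triangular H" "\<And>i. H i i \<noteq> 0"
    using assms(6) by (auto simp: gauss_borel_def lower_unitriangular_def diagonal_def
        lower_triangular_def)
  note inv = smat_inv[OF S] smat_inv[OF St] smat_inv[OF H]
  note rf [simp] = row_finite_Lam row_finite_Lam12
    row_finite_lower_triangular[OF S(1)] row_finite_lower_triangular[OF St(1)]
    row_finite_lower_triangular[OF H(1)] inv(1,4,7)[THEN row_finite_lower_triangular]
    row_finite_mult
  \<comment> \<open>The type I vectors are \<open>K\<close> applied to \<open>X1_vec\<close> and
    \<open>X2_vec\<close>, while \<open>That\<close>, \<open>T1\<close> and \<open>T2\<close> are
    the conjugates of \<open>Lam\<close>, \<open>Lam1\<close> and \<open>Lam2\<close> by
    \<open>K\<close>, with inverse \<open>K'\<close>.\<close>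
  define K K' where "K = smat_inv H \<odot> St" and "K' = smat_inv St \<odot> H"
  have rfK [simp]: "row_finite K" "row_finite K'" by (simp_all add: K_def K'_def)
  have "K' \<odot> K = smat_inv St \<odot> ((H \<odot> smat_inv H) \<odot> St)"
    by (simp add: K_def K'_def smat_mult_assoc)
  then have K'K: "K' \<odot> K = smat_one" by (simp add: inv)
  have That: "That = K \<odot> Lam \<odot> K'" and T1: "T1 = K \<odot> Lam1 \<odot> K'" and T2: "T2 = K \<odot> Lam2 \<odot> K'"
    by (simp_all add: assms K_def K'_def smat_mult_assoc)
  have A1: "A1 x = K \<odot>\<^sub>v X1_vec x" and A2: "A2 x = K \<odot>\<^sub>v X2_vec x" for x
    by (simp_all add: assms K_def)
  have conj: "K \<odot> M \<odot> K' \<odot>\<^sub>v (K \<odot>\<^sub>v v) = K \<odot>\<^sub>v (M \<odot>\<^sub>v v)" if "row_finite M" for M v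
    by (rule conj_vec) (simp_all add: that K'K)
  \<comment> \<open>Conjugation by \<open>S\<close> instead of \<open>K\<close>.\<close>
  have TB: "T \<odot>\<^sub>v B x = x \<cdot>\<^sub>v B x" for x
    by (simp add: assms conj_vec inv Lam_X smat_vec_scale)
  have Hess: "lower_Hessenberg That"
    unfolding assms by (intro lower_Hessenberg_mult_left lower_Hessenberg_mult_right
        lower_Hessenberg_Lam inv St H)
  \<comment> \<open>The transfer with \<open>M = Lam \<odot> Lam\<close> gives the conjugate of the
    squared shift, which is the square of the conjugate.\<close>
  have TT: "smat_transpose T = That \<odot> That"
    unfolding That using gauss_borel_transfer[OF assms(6) moment_matrix_shift]
    by (simp add: conj_conj K'K K_def[symmetric] K'_def[symmetric] assms(11))
  have ThA1: "That \<odot>\<^sub>v A1 x = x \<cdot>\<^sub>v A2 x" and ThA2: "That \<odot>\<^sub>v A2 x = A1 x" for x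
    by (simp_all add: That A1 A2 conj Lam_X1 Lam_X2 smat_vec_scale)
  have rfTh: "row_finite That" by (simp add: That)
  \<comment> \<open>Two applications of \<open>That\<close> lead from \<open>A1\<close> through
    \<open>x\<close> times \<open>A2\<close> to \<open>x\<close> times \<open>A1\<close>, and from
    \<open>A2\<close> through \<open>A1\<close> to \<open>x\<close> times \<open>A2\<close>.\<close>
  have TA1: "smat_transpose T \<odot>\<^sub>v A1 x = x \<cdot>\<^sub>v A1 x"
    and TA2: "smat_transpose T \<odot>\<^sub>v A2 x = x \<cdot>\<^sub>v A2 x" for x
    by (simp_all add: TT smat_vec_assoc rfTh ThA1 ThA2 smat_vec_scale)
  have "smat_transpose T \<odot>\<^sub>v Q x = x \<cdot>\<^sub>v Q x" for x
  proof -
    \<comment> \<open>Linearity needs finite rows. The transpose of a lower Hessenberg matrix need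
      not have them; here they come from the factorization \<open>That \<odot> That\<close>.\<close>
    have "row_finite (smat_transpose T)" by (simp add: TT rfTh)
    then show ?thesis
      by (simp add: assms(10) smat_vec_linear TA1 TA2) (simp add: svec_scale_def algebra_simps)
  qed
  moreover have "T1 \<odot>\<^sub>v A1 x = x \<cdot>\<^sub>v A1 x" "T2 \<odot>\<^sub>v A2 x = x \<cdot>\<^sub>v A2 x"
    "T1 \<odot>\<^sub>v A2 x = (\<lambda>n. 0)" "T2 \<odot>\<^sub>v A1 x = (\<lambda>n. 0)" for x
    by (simp_all add: T1 T2 A1 A2 conj Lam1_X1 Lam1_X2 Lam2_X1 Lam2_X2 smat_vec_scale
        smat_vec_zero)
  ultimately show ?thesis
    using TB TA1 TA2 Hess TT ThA1 ThA2 by blast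
qed

end
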